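(* For an integer $n\geq 1$ define \[a_n=\max\left\{\sum_{i=1}^n (n-i+1)\bigl(1+((i+k)\bmod n)\bigr) : 1\leq k\leq n\right\},\] where $k$ ranges over integers. Then \[a_n=\frac{1}{24}\begin{cases} 7n^3+12n^2+8n, & \text{if } n \text{ is even};\\ 7n^3+12n^2+5n, & \text{otherwise}. \end{cases}\]
   Context: For an integer $j$, $j\bmod n$ denotes the remainder of $j$ upon division by $n$, an element of $\{0,1,\ldots,n-1\}$. *)

theory Defs
  imports Complex_Main
begin

definition a :: "int \<Rightarrow> int" where
  "a n = Max {(\<Sum>i=1..n. (n - i + 1) * (1 + ((i + k) mod n))) | k :: int. 1 \<le> k \<and> k \<le> n}"

end

theory Submission
  imports Defs
begin

text \<open>Only the residue \<open>k mod n\<close> matters, so let \<open>0 \<le> k < n\<close>. For \<open>1 \<le> i \<le> n\<close> the remainder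
  \<open>(i + k) mod n\<close> is \<open>i + k\<close>, diminished by \<open>n\<close> exactly when \<open>i \<ge> n - k\<close>. Summing the two parts,
  six times the sum is \<open>n (n\<^sup>2 + 6 n - 1 + 3 k (n - 2 - k))\<close>, and \<open>k (n - 2 - k)\<close> is maximal over the
  integers at \<open>k = (n - 1) div 2\<close> if \<open>n\<close> is odd and at \<open>k = n div 2 - 1\<close> if \<open>n\<close> is even.\<close>

definition shifted_sum :: "int \<Rightarrow> int \<Rightarrow> int" where
  "shifted_sum n k = (\<Sum>i=1..n. (n - i + 1) * (1 + ((i + k) mod n)))"

lemma shifted_sum_mod: "shifted_sum n (k mod n) = shifted_sum n k"
  by (simp add: shifted_sum_def mod_add_right_eq)

text \<open>Each term expands to \<open>c * d + (c - d) * i - i^2\<close>; the factor 6 clears the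
  denominators of the power sums.\<close>

lemma sum_product_linear:
  fixes c d m :: int
  assumes "0 \<le> m"
  shows "6 * (\<Sum>i=1..m. (c - i) * (d + i)) =
    6 * m * c * d + 3 * (c - d) * m * (m + 1) - m * (m + 1) * (2 * m + 1)"
  using assms
proof (induction m rule: int_ge_induct)
  case (step m)
  have "{1..m + 1} = insert (m + 1) {1..m}"
    using step.hyps by auto
  then have "6 * (\<Sum>i=1..m + 1. (c - i) * (d + i)) =
      6 * ((c - (m + 1)) * (d + (m + 1))) + 6 * (\<Sum>i=1..m. (c - i) * (d + i))"
    by (simp add: distrib_left)
  then show ?case
    unfolding step.IH by (simp add: algebra_simps)
qed simp

text \<open>The terms run through \<open>k + 1\<close>, ..., 1, so the sum is a triangular
  number.\<close>

lemma sum_tail: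
  fixes k n :: int
  assumes "0 \<le> k"
  shows "2 * (\<Sum>i=n - k..n. n - i + 1) = (k + 1) * (k + 2)"
  using assms
proof (induction k rule: int_ge_induct)
  case (step k)
  have "{n - (k + 1)..n} = insert (n - (k + 1)) {n - k..n}"
    using step.hyps by auto
  then show ?case
    using step.IH by (simp add: algebra_simps)
qed simp

lemma shifted_sum_closed_form:
  assumes "0 \<le> k" "k < n"
  shows "6 * shifted_sum n k = n * (n ^ 2 + 6 * n - 1 + 3 * (k * (n - 2 - k)))"
proof -
  have md: "(i + k) mod n = i + k - (if n - k \<le> i then n else 0)" if "i \<in> {1..n}" for i
  proof (cases "n - k \<le> i")
    case True
    then have "(i + k - n) mod n = i + k - n"
      using that assms by (intro mod_pos_pos_trivial) auto
    then show ?thesis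
      using True by simp
  qed (use that assms in simp)
  have "shifted_sum n k =
      (\<Sum>i=1..n. (n + 1 - i) * (1 + k + i) - (if n - k \<le> i then n * (n - i + 1) else 0))"
    unfolding shifted_sum_def by (rule sum.cong) (simp_all add: md algebra_simps)
  also have "\<dots> = (\<Sum>i=1..n. (n + 1 - i) * (1 + k + i))
      - (\<Sum>i\<in>{i \<in> {1..n}. n - k \<le> i}. n * (n - i + 1))"
    by (simp only: sum_subtractf sum.inter_filter[symmetric] finite_atLeastAtMost_int)
  \<comment> \<open>Here \<open>k < n\<close> matters: it makes \<open>n - k\<close> at least
    1.\<close>
  also have "{i \<in> {1..n}. n - k \<le> i} = {n - k..n}"
    using assms by auto
  finally have "6 * shifted_sum n k = 6 * (\<Sum>i=1..n. (n + 1 - i) * (1 + k + i))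
      - 3 * n * (2 * (\<Sum>i=n - k..n. n - i + 1))"
    by (simp add: sum_distrib_left[symmetric])
  also have "\<dots> = n * (n ^ 2 + 6 * n - 1 + 3 * (k * (n - 2 - k)))"
    unfolding sum_tail[OF assms(1)] using assms
    by (subst sum_product_linear) (auto simp: algebra_simps power2_eq_square)
  finally show ?thesis .
qed

text \<open>In the closed form \<open>k * (n - 2 - k)\<close> has the positive coefficient
  \<open>3 * n\<close>, so a maximiser of this quadratic also maximises the sum.\<close>

lemma a_eq_shifted_sum:
  assumes k0: "0 \<le> k0" "k0 < n"
    and max: "\<And>k. k * (n - 2 - k) \<le> k0 * (n - 2 - k0)"
  shows "a n = shifted_sum n k0"
proof -
  have "a n = Max (shifted_sum n ` {1..n})"
    unfolding a_def shifted_sum_def by (rule arg_cong[of _ _ Max]) auto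
  also have "\<dots> = shifted_sum n k0"
  proof (rule Max_eqI)
    fix y assume "y \<in> shifted_sum n ` {1..n}"
    then obtain k where "y = shifted_sum n k"
      by auto
    \<comment> \<open>The closed form does not cover \<open>k = n\<close>, hence the passage to the
      residue.\<close>
    then have y: "y = shifted_sum n (k mod n)"
      by (simp add: shifted_sum_mod)
    have "6 * y \<le> 6 * shifted_sum n k0"
      using k0 max[of "k mod n"] by (simp only: y, subst (1 2) shifted_sum_closed_form)
        (auto intro!: mult_left_mono)
    then show "y \<le> shifted_sum n k0"
      by simp
  next
    \<comment> \<open>The range starts at 1, so residue 0 is represented by
      \<open>n\<close>.\<close>
    have "shifted_sum n k0 = shifted_sum n (if k0 = 0 then n else k0)"
      using shifted_sum_mod[of n n] by simp
    then show "shifted_sum n k0 \<in> shifted_sum n ` {1..n}"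
      using k0 by (auto split: if_splits)
  qed simp
  finally show ?thesis .
qed

theorem theorem6:
  fixes n :: int
  assumes "n \<ge> 1"
  shows "real_of_int (a n) = 1 / 24 *
    (if even n then 7 * real_of_int n ^ 3 + 12 * real_of_int n ^ 2 + 8 * real_of_int n
     else 7 * real_of_int n ^ 3 + 12 * real_of_int n ^ 2 + 5 * real_of_int n)"
proof -
  have "24 * a n = (if even n then 7 * n ^ 3 + 12 * n ^ 2 + 8 * n
     else 7 * n ^ 3 + 12 * n ^ 2 + 5 * n)"
  proof (cases "even n")
    case True
    then obtain t where n: "n = 2 * t" ..
    \<comment> \<open>The right side exceeds the left by \<open>(t - 1 - k)^2\<close>.\<close>
    have "k * (n - 2 - k) \<le> (t - 1) * (n - 2 - (t - 1))" for k
      using zero_le_square[of "t - 1 - k"] by (simp add: n algebra_simps)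
    then have "a n = shifted_sum n (t - 1)"
      using assms n by (intro a_eq_shifted_sum) auto
    then show ?thesis
      using shifted_sum_closed_form[of "t - 1" n] assms True
      by (simp add: n algebra_simps power2_eq_square power3_eq_cube)
  next
    case False
    then obtain t where n: "n = 2 * t + 1" by (elim oddE)
    \<comment> \<open>The vertex lies midway between \<open>t - 1\<close> and \<open>t\<close>,
      which tie; \<open>t\<close> is a valid residue even for \<open>n = 1\<close>, where
      \<open>t - 1\<close> is negative.\<close>
    have "k * (n - 2 - k) \<le> t * (n - 2 - t)" for k
    proof -
      \<comment> \<open>No integer lies strictly between \<open>t - 1\<close> and \<open>t\<close>.\<close>
      have "0 \<le> (t - k) * (t - 1 - k)"
        by (cases "k < t") (auto intro: mult_nonneg_nonneg mult_nonpos_nonpos)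
      then show ?thesis
        by (simp add: n algebra_simps)
    qed
    then have "a n = shifted_sum n t"
      using assms n by (intro a_eq_shifted_sum) auto
    then show ?thesis
      using shifted_sum_closed_form[of t n] assms False
      by (simp add: n algebra_simps power2_eq_square power3_eq_cube)
  qed
  then have "real_of_int (24 * a n) = real_of_int (if even n then 7 * n ^ 3 + 12 * n ^ 2 + 8 * n
     else 7 * n ^ 3 + 12 * n ^ 2 + 5 * n)"
    by (rule arg_cong)
  then show ?thesis
    by (simp split: if_splits)
qed

end
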